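(* A graph $G$ is a $3$-$\chi_i$-lower-game-vertex-critical graph if and only if $G$ is an odd cycle.
   Context: All graphs are simple, undirected and finite. The indicated coloring game on a graph $G$ with color set $\{1,\ldots,k\}$ is played by Ann and Ben. In every round Ann selects a previously uncolored vertex and Ben colors it with any color from $\{1,\ldots,k\}$ that has not been used on its neighbors. Ann's goal is a proper coloring of the whole graph; Ben wins if at some point there is an uncolored vertex having all colors $1,\ldots,k$ in its neighborhood. The indicated chromatic number $\chi_i(G)$ is the minimum $k$ for which Ann has a winning strategy on $G$, no matter how Ben plays. For $x\in V(G)$, $G-x$ is the graph obtained from $G$ by deleting $x$ and all edges incident with $x$. A graph $G$ is $k$-$\chi_i$-lower-game-vertex-critical if $\chi_i(G)=k$ and $\chi_i(G-x)<\chi_i(G)$ for every $x\in V(G)$. An odd cycle is a cycle graph $C_{2m+1}$ with $m\geq 1$. *)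

theory Defs
  imports Graph_Theory.Pair_Digraph Graph_Theory.Digraph_Isomorphism
begin

(* A simple, undirected, finite graph is a digraph satisfying the locale predicate "graph":
   finite, loop-free, without parallel arcs, and with a symmetric adjacency relation.
   The deletion G - x is "pre_digraph.del_vert G x". *)

definition neighbours :: "('a, 'b) pre_digraph \<Rightarrow> 'a \<Rightarrow> 'a set" where
  "neighbours G v = {u \<in> verts G. v \<rightarrow>\<^bsub>G\<^esub> u}"


(* A history of the indicated coloring game lists the rounds played so far, latest round first,
   as pairs of the vertex selected by Ann and the color given to it by Ben. A vertex never occurs
   twice, so "map_of h" is the partial coloring reached after the history h. *)

type_synonym 'a history = "('a \<times> nat) list"

definition uncolored :: "('a, 'b) pre_digraph \<Rightarrow> 'a history \<Rightarrow> 'a set" where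
  "uncolored G h = {v \<in> verts G. map_of h v = None}"

definition neighbour_colors :: "('a, 'b) pre_digraph \<Rightarrow> 'a history \<Rightarrow> 'a \<Rightarrow> nat set" where
  "neighbour_colors G h v = {c. \<exists>u \<in> neighbours G v. map_of h u = Some c}"

definition Ben_has_won :: "('a, 'b) pre_digraph \<Rightarrow> nat \<Rightarrow> 'a history \<Rightarrow> bool" where
  "Ben_has_won G k h \<longleftrightarrow> (\<exists>v \<in> uncolored G h. {1..k} \<subseteq> neighbour_colors G h v)"

(* The histories that can arise, for some play of Ben, when Ann follows the strategy s,
   which tells her the next vertex to select. *)

inductive possible_history ::
  "('a, 'b) pre_digraph \<Rightarrow> nat \<Rightarrow> ('a history \<Rightarrow> 'a) \<Rightarrow> 'a history \<Rightarrow> bool"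
  for G :: "('a, 'b) pre_digraph" and k :: nat and s :: "'a history \<Rightarrow> 'a"
where
  start: "possible_history G k s []"
| round: "possible_history G k s h \<Longrightarrow> s h \<in> uncolored G h \<Longrightarrow>
    c \<in> {1..k} - neighbour_colors G h (s h) \<Longrightarrow> possible_history G k s ((s h, c) # h)"

(* The second conjunct says that Ann's selections are legal. Every round colors a vertex, so
   on a finite graph a play in which Ben never wins ends with a proper coloring of the graph. *)

definition Ann_winning_strategy ::
  "('a, 'b) pre_digraph \<Rightarrow> nat \<Rightarrow> ('a history \<Rightarrow> 'a) \<Rightarrow> bool"
where
  "Ann_winning_strategy G k s \<longleftrightarrow>
    (\<forall>h. possible_history G k s h \<longrightarrow>
      \<not> Ben_has_won G k h \<and> (uncolored G h \<noteq> {} \<longrightarrow> s h \<in> uncolored G h))"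

definition indicated_chromatic_number :: "('a, 'b) pre_digraph \<Rightarrow> nat" where
  "indicated_chromatic_number G = (LEAST k. \<exists>s. Ann_winning_strategy G k s)"

definition lower_game_vertex_critical :: "nat \<Rightarrow> ('a, 'b) pre_digraph \<Rightarrow> bool" where
  "lower_game_vertex_critical k G \<longleftrightarrow>
    indicated_chromatic_number G = k \<and>
    (\<forall>x \<in> verts G.
      indicated_chromatic_number (pre_digraph.del_vert G x) < indicated_chromatic_number G)"


(* For n < 3 this is not a simple cycle; only odd n \<ge> 3 is used below. *)

definition cycle_graph :: "nat \<Rightarrow> (nat, nat \<times> nat) pre_digraph" where
  "cycle_graph n = with_proj
    \<lparr> pverts = {..<n},
      parcs = {(i, j). i < n \<and> j < n \<and> (j = (i + 1) mod n \<or> i = (j + 1) mod n)} \<rparr>"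

lemma graph_cycle_graph:
  assumes "n \<ge> 2"
  shows "graph (cycle_graph n)"
proof -
  let ?C = "\<lparr> pverts = {..<n},
      parcs = {(i, j). i < n \<and> j < n \<and> (j = (i + 1) mod n \<or> i = (j + 1) mod n)} \<rparr>"
  have "finite (parcs ?C)"
    by (rule finite_subset[of _ "{..<n} \<times> {..<n}"]) auto
  moreover have "i < n \<Longrightarrow> i = Suc i mod n \<Longrightarrow> False"
    and "i < n \<Longrightarrow> Suc i mod n = i \<Longrightarrow> False" for i
    using assms by (cases "Suc i = n"; auto)+
  ultimately have "pair_graph ?C"
    by unfold_locales (auto simp: symmetric_def intro!: symI)
  then show ?thesis
    unfolding cycle_graph_def by (rule pair_graph.pair_graphD_graph)
qed

definition odd_cycle :: "('a, 'b) pre_digraph \<Rightarrow> bool" where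
  "odd_cycle G \<longleftrightarrow> (\<exists>m \<ge> 1. digraph_iso G (cycle_graph (2 * m + 1)))"

end

theory Submission
  imports Defs
begin

text \<open>Ann wins with two colors on every bipartite graph, by coloring each component along a connected
  ordering of its vertices. Hence the indicated chromatic number is at most 2 exactly for bipartite
  graphs, and a 3-critical graph is a non-bipartite graph all of whose vertex-deleted subgraphs are
  bipartite. A shortest odd closed walk in such a graph is an induced cycle by minimality and visits
  every vertex, since it would survive the deletion of any other one. Conversely, three colors
  suffice on an odd cycle because all degrees are 2.\<close>

unbundle no funcset_syntax

section \<open>Two-colorability and odd closed walks\<close>

text \<open>Formulated for a bare relation, so that it applies to \<open>arcs_ends\<close> of the
  graph and of its vertex deletions alike.\<close>

definition two_colorable :: "'a rel \<Rightarrow> bool" where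
  "two_colorable R \<longleftrightarrow> (\<exists>c :: 'a \<Rightarrow> bool. \<forall>u v. (u, v) \<in> R \<longrightarrow> c u \<noteq> c v)"

lemma two_colorableE:
  assumes "two_colorable R"
  obtains c :: "'a \<Rightarrow> bool" where "\<And>u v. (u, v) \<in> R \<Longrightarrow> c u \<noteq> c v"
  using assms unfolding two_colorable_def by (elim exE) (use that in blast)

lemma relpow_sym:
  assumes "sym R" "(u, v) \<in> R ^^ n"
  shows "(v, u) \<in> R ^^ n"
  using assms(2)
proof (induction n arbitrary: v)
  case (Suc n)
  then obtain w where "(u, w) \<in> R ^^ n" "(w, v) \<in> R"
    by auto
  with Suc.IH assms(1) show ?case
    by (meson relpow_Suc_I2 symD)
qed simp

lemma relpow_parity:
  assumes "\<And>u v. (u, v) \<in> R \<Longrightarrow> c u \<noteq> c v" "(u, v) \<in> R ^^ n"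
  shows "even n \<longleftrightarrow> (c u \<longleftrightarrow> c v)"
  using assms(2)
proof (induction n arbitrary: v)
  case (Suc n)
  then obtain w where "(u, w) \<in> R ^^ n" "(w, v) \<in> R"
    by auto
  moreover from this have "c w \<noteq> c v"
    using assms(1) by blast
  ultimately show ?case
    using Suc.IH[of w] by auto
qed simp

text \<open>Colors alternate along walks, which excludes odd closed ones. Conversely, each vertex is
  colored by the parity of a walk from a root of its component; a monochromatic edge would join two
  walks of equal parity into an odd closed walk.\<close>

lemma two_colorable_iff_no_odd_closed_walk:
  assumes "sym R"
  shows "two_colorable R \<longleftrightarrow> (\<forall>n v. odd n \<longrightarrow> (v, v) \<notin> R ^^ n)"
proof
  assume "two_colorable R"
  then obtain c :: "'a \<Rightarrow> bool" where "\<And>u v. (u, v) \<in> R \<Longrightarrow> c u \<noteq> c v"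
    by (rule two_colorableE) blast
  from relpow_parity[where c = c, OF this] show "\<forall>n v. odd n \<longrightarrow> (v, v) \<notin> R ^^ n"
    by blast
next
  assume no_odd: "\<forall>n v. odd n \<longrightarrow> (v, v) \<notin> R ^^ n"
  \<comment> \<open>The choice depends only on the set of vertices from which \<open>v\<close> is
    reachable, so adjacent vertices get the same root.\<close>
  define root where "root v = (SOME u. (u, v) \<in> R\<^sup>*)" for v
  define c where "c v \<longleftrightarrow> (\<exists>n. even n \<and> (root v, v) \<in> R ^^ n)" for v
  have root: "(root v, v) \<in> R\<^sup>*" for v
    unfolding root_def by (rule someI[of _ v]) simp
  have "c u \<noteq> c v" if uv: "(u, v) \<in> R" for u v
  proof
    assume eq: "c u = c v"
    have "(w, u) \<in> R\<^sup>* \<longleftrightarrow> (w, v) \<in> R\<^sup>*" for w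
      using uv symD[OF assms uv] by (meson rtrancl.rtrancl_into_rtrancl)
    then have same: "root u = root v"
      unfolding root_def by simp
    have "\<exists>m n. (root u, u) \<in> R ^^ m \<and> (root u, v) \<in> R ^^ n \<and> even (m + n)"
    proof (cases "c u")
      case True
      then show ?thesis
        using eq same unfolding c_def by (metis even_add)
    next
      \<comment> \<open>Neither \<open>u\<close> nor \<open>v\<close> is reached from the root by an
        even walk, so arbitrary walks to them are both odd.\<close>
      case False
      obtain m n where "(root u, u) \<in> R ^^ m" "(root v, v) \<in> R ^^ n"
        using root rtrancl_imp_relpow by metis
      with False eq same show ?thesis
        unfolding c_def by (metis even_add)
    qed
    then obtain m n where "(root u, u) \<in> R ^^ m" "(root u, v) \<in> R ^^ n" "even (m + n)"
      by blast
    then have "(root u, root u) \<in> R ^^ (Suc m + n)"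
      using relpow_trans[OF relpow_Suc_I[OF _ uv] relpow_sym[OF assms]] by blast
    moreover have "odd (Suc m + n)"
      using \<open>even (m + n)\<close> by simp
    ultimately show False
      using no_odd by blast
  qed
  then show "two_colorable R"
    unfolding two_colorable_def by blast
qed

section \<open>Induced odd cycles and paths\<close>

lemma relpow_segment:
  assumes "\<And>i. i < n \<Longrightarrow> (f i, f (Suc i)) \<in> R" "i \<le> j" "j \<le> n"
  shows "(f i, f j) \<in> R ^^ (j - i)"
  unfolding relpow_fun_conv
  using assms by (intro exI[of _ "\<lambda>k. f (i + k)"]) auto

text \<open>The adjacency condition of \<open>cycle_graph\<close> without the index bounds, which
  the lemmas carry separately.\<close>

definition cyc_adj :: "nat \<Rightarrow> nat \<Rightarrow> nat \<Rightarrow> bool" where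
  "cyc_adj n i j \<longleftrightarrow> j = Suc i mod n \<or> i = Suc j mod n"

lemma cyc_adj_iff:
  assumes "i < n" "j < n"
  shows "cyc_adj n i j \<longleftrightarrow> j = Suc i \<or> i = Suc j \<or> (i = 0 \<and> Suc j = n) \<or> (j = 0 \<and> Suc i = n)"
  using assms by (auto simp: cyc_adj_def mod_Suc)

text \<open>In a shortest odd closed walk, a repeated vertex or a chord would split off a shorter
  odd closed walk.\<close>

lemma shortest_odd_closed_walk:
  assumes "sym R" "irrefl R" "\<not> two_colorable R"
  obtains n f where "odd n" "n \<ge> 3" "inj_on f {..<n}"
    "\<And>i j. i < n \<Longrightarrow> j < n \<Longrightarrow> (f i, f j) \<in> R \<longleftrightarrow> cyc_adj n i j"
proof -
  define n where "n = (LEAST n. odd n \<and> (\<exists>v. (v, v) \<in> R ^^ n))"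
  have "\<exists>n. odd n \<and> (\<exists>v. (v, v) \<in> R ^^ n)"
    using assms two_colorable_iff_no_odd_closed_walk by blast
  then have "odd n \<and> (\<exists>v. (v, v) \<in> R ^^ n)"
    unfolding n_def by (rule LeastI_ex)
  then obtain v where odd: "odd n" and v: "(v, v) \<in> R ^^ n"
    by blast
  have minimal: "n \<le> m" if "odd m" "(w, w) \<in> R ^^ m" for m w
    unfolding n_def using that by (blast intro: Least_le)
  \<comment> \<open>A closed walk of length 1 would be a loop.\<close>
  have "n \<noteq> 1"
    using v assms(2) by (auto simp: irrefl_def)
  with odd have "n \<ge> 3"
    by presburger
  obtain f where f: "f 0 = v" "f n = v" "\<And>i. i < n \<Longrightarrow> (f i, f (Suc i)) \<in> R"
    using v unfolding relpow_fun_conv by blast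
  note segment = relpow_segment[of n f R, OF f(3)]
  text \<open>A walk of length \<open>d\<close> joining two vertices of the closed walk splits it into two closed
    walks of total length \<open>n + 2 * d\<close>, so one of them is odd.\<close>
  have split: "n \<le> (j - i) + d \<or> n \<le> n - (j - i) + d"
    if "i \<le> j" "j < n" "(f i, f j) \<in> R ^^ d" for i j d
  proof -
    have "(f j, f n) \<in> R ^^ (n - j)" "(f n, f i) \<in> R ^^ i"
      using segment[of j n] segment[of 0 i] that f(1,2) by auto
    then have "(f j, f i) \<in> R ^^ (n - j + i)"
      by (rule relpow_trans)
    then have "(f i, f i) \<in> R ^^ (d + (n - j + i))"
      using that(3) by (rule relpow_trans[rotated])
    moreover have "(f i, f i) \<in> R ^^ ((j - i) + d)"
      using that by (intro relpow_trans[OF segment relpow_sym[OF assms(1)]]) auto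
    moreover have "d + (n - j + i) = n - (j - i) + d"
      using that by simp
    moreover have "odd ((j - i) + d) \<or> odd (n - (j - i) + d)"
    proof -
      have "odd ((j - i) + (n - (j - i)))"
        using odd that by simp
      then show ?thesis
        unfolding even_add by blast
    qed
    ultimately show ?thesis
      using minimal by metis
  qed
  \<comment> \<open>With \<open>d = 0\<close> the bound leaves only \<open>j - i = 0\<close>,
    because \<open>j - i < n\<close>.\<close>
  have inj: "i = j" if "i \<le> j" "j < n" "f i = f j" for i j
    using split[of i j 0] that by auto
  have adj: "(f i, f j) \<in> R \<longleftrightarrow> cyc_adj n i j" if "i \<le> j" "j < n" for i j
  proof
    assume R: "(f i, f j) \<in> R"
    then have "i \<noteq> j"
      using assms(2) by (auto simp: irrefl_def)
    \<comment> \<open>With \<open>d = 1\<close> the difference of the indices is at most 1 or at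
      least \<open>n - 1\<close>: the edge belongs to the walk.\<close>
    moreover have "n \<le> (j - i) + 1 \<or> n \<le> n - (j - i) + 1"
      using split[of i j 1] R that by simp
    ultimately have "(i = 0 \<and> Suc j = n) \<or> j = Suc i"
      using that by linarith
    then show "cyc_adj n i j"
      using that cyc_adj_iff[of i n j] by auto
  next
    assume "cyc_adj n i j"
    then have "j = Suc i \<or> i = 0 \<and> Suc j = n"
      using that \<open>n \<ge> 3\<close> cyc_adj_iff[of i n j] by auto
    then show "(f i, f j) \<in> R"
      using f(3)[of i] f(1,2) f(3)[of j] that symD[OF assms(1), of "f j" "f i"] by auto
  qed
  show ?thesis
  proof (rule that[OF odd \<open>n \<ge> 3\<close>])
    show "inj_on f {..<n}"
      using inj by (metis inj_onI lessThan_iff nat_le_linear)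
    show "(f i, f j) \<in> R \<longleftrightarrow> cyc_adj n i j" if "i < n" "j < n" for i j
      using adj[of i j] adj[of j i] that symD[OF assms(1)]
      by (metis cyc_adj_def nat_le_linear)
  qed
qed

text \<open>One turn around the indices is an odd closed walk. Only one implication is asked of
  \<open>R\<close>, so the cycle may lie inside a larger graph.\<close>

lemma cyc_adj_not_two_colorable:
  assumes "odd n" "\<And>i j. i < n \<Longrightarrow> j < n \<Longrightarrow> cyc_adj n i j \<Longrightarrow> (f i, f j) \<in> R"
  shows "\<not> two_colorable R"
proof
  assume "two_colorable R"
  then obtain c :: "'a \<Rightarrow> bool" where c: "\<And>u v. (u, v) \<in> R \<Longrightarrow> c u \<noteq> c v"
    by (rule two_colorableE) blast
  have "0 < n"
    using assms(1) by (rule odd_pos)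
  then have step: "(f (i mod n), f (Suc i mod n)) \<in> R" for i
    using assms(2) by (simp add: cyc_adj_def mod_Suc_eq)
  \<comment> \<open>Both ends are \<open>f 0\<close>, so parity would force \<open>n\<close> to be
    even.\<close>
  have "(f (0 mod n), f (n mod n)) \<in> R ^^ n"
    unfolding relpow_fun_conv using step by (intro exI[of _ "\<lambda>i. f (i mod n)"]) blast
  with relpow_parity[OF c] assms(1) show False
    by fastforce
qed

text \<open>Cutting an odd cycle at the index \<open>a\<close> leaves a path, whose alternating
  coloring is pulled back along \<open>g\<close>.\<close>

lemma cyc_adj_delete_two_colorable:
  assumes "odd n" "a < n" "\<And>u v. (u, v) \<in> R \<Longrightarrow> g u < n \<and> g v < n \<and> g u \<noteq> a \<and> g v \<noteq> a \<and> cyc_adj n (g u) (g v)"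
  shows "two_colorable R"
proof -
  \<comment> \<open>Index parity, inverted from \<open>a\<close> onwards. The inversion repairs the
    pair \<open>n - 1\<close>, \<open>0\<close>, both even, and does harm only between
    \<open>a - 1\<close> and \<open>a\<close>, where the path is cut.\<close>
  define c where "c i \<longleftrightarrow> (even i \<longleftrightarrow> i < a)" for i
  have "c i \<noteq> c j" if "i < n" "i \<noteq> a" "j \<noteq> a" "j = Suc i mod n" for i j
    using that assms(1,2) unfolding c_def by (cases "Suc i = n") auto
  then have "c (g u) \<noteq> c (g v)" if "(u, v) \<in> R" for u v
    using assms(3)[OF that] unfolding cyc_adj_def by metis
  then show ?thesis
    unfolding two_colorable_def by (intro exI[of _ "\<lambda>v. c (g v)"]) auto
qed

section \<open>Plays of the game, proper colorings and winning strategies\<close>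

lemma possible_history_distinct:
  assumes "possible_history G k s h"
  shows "distinct (map fst h)" "fst ` set h \<subseteq> verts G"
  using assms
  by (induction) (auto simp: uncolored_def map_of_eq_None_iff)

lemma possible_history_colors:
  assumes "possible_history G k s h" "map_of h v = Some c"
  shows "c \<in> {1..k}"
  using assms by (induction) (auto split: if_splits)

context graph
begin

lemma possible_history_proper:
  assumes "possible_history G k s h" "u \<rightarrow> v" "map_of h u = Some c" "map_of h v = Some d"
  shows "c \<noteq> d"
  using assms
proof (induction arbitrary: u v c d)
  case (round h e)
  have "u \<noteq> v" "u \<in> verts G" "v \<in> verts G" "v \<rightarrow> u"
    using round.prems(1) adj_not_same adj_in_verts arcs_ends_symmetric[OF sym_arcs] by blast+
  then have nb: "u \<in> neighbours G v" "v \<in> neighbours G u"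
    using round.prems(1) unfolding neighbours_def by auto
  consider "u = s h" | "v = s h" | "u \<noteq> s h" "v \<noteq> s h"
    by blast
  then show ?case
  proof cases
    case 1
    then have "map_of h v = Some d" "c = e"
      using round.prems \<open>u \<noteq> v\<close> by auto
    then show ?thesis
      using 1 round.hyps(3) nb(2) unfolding neighbour_colors_def by blast
  next
    case 2
    then have "map_of h u = Some c" "d = e"
      using round.prems \<open>u \<noteq> v\<close> by auto
    then show ?thesis
      using 2 round.hyps(3) nb(1) unfolding neighbour_colors_def by blast
  next
    case 3
    then show ?thesis
      using round.IH round.prems by auto
  qed
qed simp

text \<open>Plays have bounded length, so a longest one exists. It colors every vertex: otherwise
  Ann could select a vertex and, as Ben has not won, a legal color would extend the play.\<close>

lemma Ann_wins_imp_proper_coloring: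
  assumes "Ann_winning_strategy G k s"
  obtains f where "\<And>u v. u \<rightarrow> v \<Longrightarrow> f u \<noteq> f v \<and> f u \<in> {1..k} \<and> f v \<in> {1..k}"
proof -
  have bound: "length h \<le> card (verts G)" if "possible_history G k s h" for h
  proof -
    have "length h = card (fst ` set h)"
      using possible_history_distinct(1)[OF that] by (metis distinct_card length_map set_map)
    also have "\<dots> \<le> card (verts G)"
      using possible_history_distinct(2)[OF that] by (rule card_mono[OF finite_verts])
    finally show ?thesis .
  qed
  obtain h where h: "possible_history G k s h"
    and max: "\<And>h'. possible_history G k s h' \<Longrightarrow> length h' \<le> length h"
    using ex_has_greatest_nat[where P = "possible_history G k s" and k = "[]" and f = length
        and b = "Suc (card (verts G))"] possible_history.start bound le_imp_less_Suc
    by metis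
  have "uncolored G h = {}"
  proof (rule ccontr)
    assume "uncolored G h \<noteq> {}"
    then have "s h \<in> uncolored G h" "\<not> Ben_has_won G k h"
      using assms h unfolding Ann_winning_strategy_def by auto
    then obtain c where "c \<in> {1..k} - neighbour_colors G h (s h)"
      unfolding Ben_has_won_def by blast
    from max[OF possible_history.round[OF h \<open>s h \<in> uncolored G h\<close> this]] show False
      by simp
  qed
  then have "map_of h u = Some (the (map_of h u))" if "u \<in> verts G" for u
    using that unfolding uncolored_def by auto
  then show thesis
    using that[of "\<lambda>u. the (map_of h u)"] possible_history_proper[OF h]
      possible_history_colors[OF h] adj_in_verts by metis
qed

lemma Ann_wins_2_imp_two_colorable:
  assumes "Ann_winning_strategy G k s" "k \<le> 2"
  shows "two_colorable (arcs_ends G)"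
proof -
  obtain f where f: "\<And>u v. u \<rightarrow> v \<Longrightarrow> f u \<noteq> f v \<and> f u \<in> {1..k} \<and> f v \<in> {1..k}"
    using Ann_wins_imp_proper_coloring[OF assms(1)] by blast
  \<comment> \<open>Of two distinct colors in \<open>{1..k}\<close> with \<open>k \<le> 2\<close>,
    exactly one is 1.\<close>
  have "(f u = 1) \<noteq> (f v = 1)" if "u \<rightarrow> v" for u v
    using f[OF that] assms(2) by auto
  then show ?thesis
    unfolding two_colorable_def by (intro exI[of _ "\<lambda>v. f v = 1"]) auto
qed

text \<open>Fewer than \<open>k\<close> neighbours never show all \<open>k\<close> colors, so every
  legal order of selection wins.\<close>

lemma Ann_wins_if_degree_less:
  assumes "\<And>v. v \<in> verts G \<Longrightarrow> card (neighbours G v) < k"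
  shows "\<exists>s. Ann_winning_strategy G k s"
proof -
  have "\<not> Ben_has_won G k h" for h
  proof
    assume "Ben_has_won G k h"
    then obtain v where v: "v \<in> verts G" "{1..k} \<subseteq> neighbour_colors G h v"
      unfolding Ben_has_won_def uncolored_def by auto
    have fin: "finite (neighbours G v)"
      unfolding neighbours_def by simp
    have "neighbour_colors G h v \<subseteq> (\<lambda>u. the (map_of h u)) ` neighbours G v"
      unfolding neighbour_colors_def by force
    with v(2) have "card {1..k} \<le> card (neighbours G v)"
      using surj_card_le[OF fin] by (meson subset_trans)
    with assms[OF v(1)] show False
      by simp
  qed
  then have "Ann_winning_strategy G k (\<lambda>h. SOME v. v \<in> uncolored G h)"
    unfolding Ann_winning_strategy_def by (auto intro: someI)
  then show ?thesis
    by blast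
qed

text \<open>Ann selects a vertex with a colored neighbour whenever there is one. Then Ben's color is
  forced except when he starts a new component, so the partial coloring always extends to a proper
  2-coloring (after exchanging the two colors on the uncolored vertices if necessary).\<close>
lemma two_colorable_imp_Ann_wins_2:
  assumes "two_colorable (arcs_ends G)"
  shows "\<exists>s. Ann_winning_strategy G 2 s"
proof -
  define good where "good h v \<longleftrightarrow>
    v \<in> uncolored G h \<and> neighbour_colors G h v \<noteq> {}" for h v
  define s where "s h = (if \<exists>v. good h v then SOME v. good h v
    else SOME v. v \<in> uncolored G h)" for h
  \<comment> \<open>The invariant of the play: \<open>f\<close> is a proper coloring of the whole
    graph with colors 1 and 2 that extends the partial coloring.\<close>
  define ext where "ext h f \<longleftrightarrow> (\<forall>v\<in>verts G. f v \<in> {1..2::nat}) \<and>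
    (\<forall>u v. u \<rightarrow> v \<longrightarrow> f u \<noteq> f v) \<and> (\<forall>v c. map_of h v = Some c \<longrightarrow> f v = c)" for h f
  have good_s: "good h (s h)" if "good h v" for h v
    using that unfolding s_def by (auto intro: someI)
  have legal: "s h \<in> uncolored G h" if "uncolored G h \<noteq> {}" for h
  proof (cases "\<exists>v. good h v")
    case True
    then show ?thesis
      using good_s good_def by metis
  next
    case False
    then show ?thesis
      using that unfolding s_def by (auto intro: someI)
  qed
  have sym: "v \<rightarrow> u" if "u \<rightarrow> v" for u v
    using that by (rule arcs_ends_symmetric[OF sym_arcs])
  have "\<exists>f. ext h f" if "possible_history G 2 s h" for h
    using that
  proof induction
    case start
    from assms obtain c :: "'a \<Rightarrow> bool" where "\<And>u v. u \<rightarrow> v \<Longrightarrow> c u \<noteq> c v"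
      by (rule two_colorableE) blast
    then have "ext [] (\<lambda>v. if c v then 1 else 2)"
      unfolding ext_def by auto
    then show ?case
      by blast
  next
    case (round h c)
    then obtain f where f: "ext h f"
      by blast
    define v where "v = s h"
    have v: "v \<in> verts G" "map_of h v = None"
      using round.hyps(2) unfolding v_def uncolored_def by auto
    have c: "c \<in> {1..2}" "c \<notin> neighbour_colors G h v"
      using round.hyps(3) unfolding v_def by auto
    show ?case
    proof (cases "f v = c")
      case True
      then have "ext ((s h, c) # h) f"
        using f unfolding ext_def v_def by simp
      then show ?thesis
        by blast
    next
      case False
      \<comment> \<open>A colored neighbour would leave only one color for \<open>v\<close>, namely
        \<open>f v\<close>, but Ben chose another.\<close>
      have "\<not> good h v"
      proof
        assume "good h v"
        then obtain u d where u: "u \<in> neighbours G v" "map_of h u = Some d"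
          unfolding good_def neighbour_colors_def by blast
        then have "u \<in> verts G" "v \<rightarrow> u"
          unfolding neighbours_def by auto
        then have "f v \<noteq> f u" "f u = d" "f u \<in> {1..2}" "f v \<in> {1..2}"
          using f v u(2) unfolding ext_def by blast+
        moreover have "d \<noteq> c"
          using u c(2) unfolding neighbour_colors_def by blast
        ultimately show False
          using c(1) False by auto
      qed
      \<comment> \<open>Ann takes a good vertex whenever there is one, so now none exists: no edge
        joins a colored and an uncolored vertex.\<close>
      then have closed: "\<not> u \<rightarrow> w" if "u \<in> uncolored G h" "map_of h w \<noteq> None" for u w
        using good_s[of h u] that adj_in_verts
        unfolding good_def v_def neighbour_colors_def neighbours_def by blast
      \<comment> \<open>The map \<open>3 - f u\<close> exchanges the colors 1 and 2. Exchanging them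
        on the uncolored vertices keeps \<open>f\<close> proper and gives \<open>v\<close> Ben's
        color.\<close>
      define f' where "f' u = (if map_of h u = None then 3 - f u else f u)" for u
      have "f' u \<noteq> f' w" if "u \<rightarrow> w" for u w
      proof -
        have "map_of h u = None \<longleftrightarrow> map_of h w = None"
          using closed[of u w] closed[of w u] that sym[OF that] adj_in_verts[OF that]
          unfolding uncolored_def by auto
        moreover have "f u \<noteq> f w" "f u \<in> {1..2}" "f w \<in> {1..2}"
          using f that adj_in_verts[OF that] unfolding ext_def by auto
        ultimately show ?thesis
          unfolding f'_def by auto
      qed
      moreover have "f' u \<in> {1..2}" if "u \<in> verts G" for u
        using f that unfolding ext_def f'_def by force
      moreover have "f' u = d" if "map_of ((v, c) # h) u = Some d" for u d
      proof (cases "u = v")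
        case True
        moreover have "f v \<in> {1..2}"
          using f v(1) unfolding ext_def by auto
        ultimately show ?thesis
          using that v(2) c(1) False unfolding f'_def by auto
      next
        case False
        then show ?thesis
          using that f unfolding ext_def f'_def by auto
      qed
      ultimately have "ext ((s h, c) # h) f'"
        unfolding ext_def v_def by blast
      then show ?thesis
        by blast
    qed
  qed
  moreover have "\<not> Ben_has_won G 2 h" if "ext h f" for h f
  proof
    assume "Ben_has_won G 2 h"
    then obtain v where v: "v \<in> verts G" "{1..2} \<subseteq> neighbour_colors G h v"
      unfolding Ben_has_won_def uncolored_def by auto
    \<comment> \<open>All colors surround \<open>v\<close>, in particular the one that the extension
      reserves for it, contradicting properness.\<close>
    then have "f v \<in> neighbour_colors G h v"
      using that unfolding ext_def by blast
    then obtain u where "v \<rightarrow> u" "map_of h u = Some (f v)"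
      unfolding neighbour_colors_def neighbours_def by auto
    then have "f v \<noteq> f u" "f u = f v"
      using that unfolding ext_def by blast+
    then show False
      by simp
  qed
  ultimately have "Ann_winning_strategy G 2 s"
    unfolding Ann_winning_strategy_def using legal by blast
  then show ?thesis
    by blast
qed

section \<open>The indicated chromatic number and criticality\<close>

text \<open>More colors than vertices always suffice by the degree bound, so the set under
  \<open>LEAST\<close> is nonempty.\<close>

lemma indicated_chromatic_number_attained:
  "\<exists>s. Ann_winning_strategy G (indicated_chromatic_number G) s"
proof -
  have "card (neighbours G v) < Suc (card (verts G))" for v
    using card_mono[OF finite_verts, of "neighbours G v"] unfolding neighbours_def by auto
  then have "\<exists>k s. Ann_winning_strategy G k s"
    using Ann_wins_if_degree_less by blast
  then show ?thesis
    unfolding indicated_chromatic_number_def by (rule LeastI_ex)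
qed

lemma indicated_chromatic_number_le_2_iff:
  "indicated_chromatic_number G \<le> 2 \<longleftrightarrow> two_colorable (arcs_ends G)"
proof
  assume "indicated_chromatic_number G \<le> 2"
  then show "two_colorable (arcs_ends G)"
    using indicated_chromatic_number_attained Ann_wins_2_imp_two_colorable by blast
next
  assume "two_colorable (arcs_ends G)"
  then show "indicated_chromatic_number G \<le> 2"
    unfolding indicated_chromatic_number_def by (intro Least_le two_colorable_imp_Ann_wins_2)
qed

lemma arcs_ends_del_vert:
  "arcs_ends (del_vert x) = {(u, v) \<in> arcs_ends G. u \<noteq> x \<and> v \<noteq> x}"
  unfolding arcs_ends_conv del_vert_simps by auto

lemma graph_del_vert: "graph (del_vert x)"
proof -
  interpret H: fin_digraph "del_vert x"
    by (rule fin_digraph_del_vert)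
  show ?thesis
  proof
    show "symmetric (del_vert x)"
      using sym_arcs unfolding symmetric_def arcs_ends_del_vert sym_def by blast
    show "tail (del_vert x) e \<noteq> head (del_vert x) e" if "e \<in> arcs (del_vert x)" for e
      using that no_loops by (simp add: del_vert_simps)
    show "e1 = e2" if "e1 \<in> arcs (del_vert x)" "e2 \<in> arcs (del_vert x)"
      "arc_to_ends (del_vert x) e1 = arc_to_ends (del_vert x) e2" for e1 e2
      using that no_multi_arcs[of e1 e2] by (simp add: del_vert_simps ends_del_vert)
  qed
qed

text \<open>Values below 3 amount to two-colorability, for the graph and for its vertex deletions.
  The game thus remains only in the condition that Ann wins with three colors.\<close>

lemma lower_game_vertex_critical_3_iff:
  "lower_game_vertex_critical 3 G \<longleftrightarrow>
    (\<exists>s. Ann_winning_strategy G 3 s) \<and> \<not> two_colorable (arcs_ends G) \<and>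
    (\<forall>x\<in>verts G. two_colorable (arcs_ends (del_vert x)))"
proof -
  have del: "indicated_chromatic_number (del_vert x) < 3 \<longleftrightarrow>
      two_colorable (arcs_ends (del_vert x))" for x
    using graph.indicated_chromatic_number_le_2_iff[OF graph_del_vert[of x]] by auto
  have "indicated_chromatic_number G = 3 \<longleftrightarrow>
      (\<exists>s. Ann_winning_strategy G 3 s) \<and> \<not> two_colorable (arcs_ends G)"
  proof
    assume "indicated_chromatic_number G = 3"
    then show "(\<exists>s. Ann_winning_strategy G 3 s) \<and> \<not> two_colorable (arcs_ends G)"
      using indicated_chromatic_number_attained indicated_chromatic_number_le_2_iff by simp
  next
    assume *: "(\<exists>s. Ann_winning_strategy G 3 s) \<and> \<not> two_colorable (arcs_ends G)"
    then have "indicated_chromatic_number G \<le> 3"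
      unfolding indicated_chromatic_number_def by (blast intro: Least_le)
    then show "indicated_chromatic_number G = 3"
      using * indicated_chromatic_number_le_2_iff by linarith
  qed
  then show ?thesis
    unfolding lower_game_vertex_critical_def using del by auto
qed

section \<open>Odd cycles as indexed vertex sets\<close>

text \<open>Without parallel arcs an arc is determined by its ends, so an isomorphism amounts to an
  adjacency-preserving indexing of the vertices.\<close>

lemma odd_cycle_iff:
  "odd_cycle G \<longleftrightarrow> (\<exists>n f. odd n \<and> n \<ge> 3 \<and> bij_betw f {..<n} (verts G) \<and>
    (\<forall>i<n. \<forall>j<n. f i \<rightarrow> f j \<longleftrightarrow> cyc_adj n i j))"
  (is "_ \<longleftrightarrow> ?R")
proof
  assume "odd_cycle G"
  then obtain m h where m: "m \<ge> 1" and h: "digraph_isomorphism h"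
    and eq: "cycle_graph (2 * m + 1) = app_iso h G"
    unfolding odd_cycle_def digraph_iso_def by blast
  define n where "n = 2 * m + 1"
  define g where "g = iso_verts h"
  have inj: "inj_on g (verts G)"
    using h unfolding g_def by (rule digraph_isomorphism_inj_on_verts)
  have img: "g ` verts G = {..<n}"
    using arg_cong[OF eq, of verts] by (simp add: cycle_graph_def n_def g_def)
  have "arcs_ends (app_iso h G) = (\<lambda>(u, v). (g u, g v)) ` arcs_ends G"
    using h by (auto simp: arcs_ends_conv g_def iso_verts_tail iso_verts_head image_image)
  then have ends: "(\<lambda>(u, v). (g u, g v)) ` arcs_ends G = {(i, j). i < n \<and> j < n \<and> cyc_adj n i j}"
    using arg_cong[OF eq, of arcs_ends] by (auto simp: cycle_graph_def n_def cyc_adj_def)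
  have adj: "u \<rightarrow> v \<longleftrightarrow> cyc_adj n (g u) (g v)" if uv: "u \<in> verts G" "v \<in> verts G" for u v
  proof
    assume "u \<rightarrow> v"
    then have "(g u, g v) \<in> (\<lambda>(u, v). (g u, g v)) ` arcs_ends G"
      by force
    then show "cyc_adj n (g u) (g v)"
      unfolding ends by simp
  next
    assume "cyc_adj n (g u) (g v)"
    then have "(g u, g v) \<in> (\<lambda>(u, v). (g u, g v)) ` arcs_ends G"
      unfolding ends using uv img by blast
    then obtain u' v' where "u' \<rightarrow> v'" "g u = g u'" "g v = g v'"
      by auto
    moreover from this have "u = u'" "v = v'"
      using inj uv adj_in_verts unfolding inj_on_def by metis+
    ultimately show "u \<rightarrow> v"
      by simp
  qed
  \<comment> \<open>The isomorphism leads from the graph to the cycle, so the indexing is its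
    inverse.\<close>
  define f where "f = the_inv_into (verts G) g"
  have "bij_betw f {..<n} (verts G)"
    unfolding f_def using inj img by (intro bij_betw_the_inv_into bij_betw_imageI)
  moreover have "g (f i) = i" "f i \<in> verts G" if "i < n" for i
    unfolding f_def using inj img that
    by (auto intro!: f_the_inv_into_f the_inv_into_into)
  ultimately show ?R
    using m adj unfolding n_def by (intro exI[of _ "2 * m + 1"] exI[of _ f]) auto
next
  assume ?R
  then obtain n f where n: "odd n" "n \<ge> 3" and f: "bij_betw f {..<n} (verts G)"
    and adj: "\<And>i j. i < n \<Longrightarrow> j < n \<Longrightarrow> f i \<rightarrow> f j \<longleftrightarrow> cyc_adj n i j"
    by blast
  obtain m where m: "n = 2 * m + 1" "m \<ge> 1"
    using n by (auto elim!: oddE)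
  define g where "g = the_inv_into {..<n} f"
  have bij: "bij_betw g (verts G) {..<n}"
    unfolding g_def using f by (rule bij_betw_the_inv_into)
  have gf: "g (f i) = i" if "i < n" for i
    using f that unfolding g_def bij_betw_def by (auto intro: the_inv_into_f_f)
  have fg: "f (g v) = v" if "v \<in> verts G" for v
    using f that unfolding g_def bij_betw_def by (auto intro: f_the_inv_into_f)
  have g: "g v < n" if "v \<in> verts G" for v
    using bij that unfolding bij_betw_def by auto
  \<comment> \<open>The arcs of \<open>cycle_graph\<close> are pairs, which forces the arc map;
    \<open>fst\<close> and \<open>snd\<close> are the tail and head maps given by
    \<open>with_proj\<close>.\<close>
  define h where "h = \<lparr> iso_verts = g, iso_arcs = \<lambda>a. (g (tail G a), g (head G a)),
    iso_head = snd, iso_tail = fst \<rparr>"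
  have "inj_on (\<lambda>a. (g (tail G a), g (head G a))) (arcs G)"
    using bij no_multi_arcs unfolding bij_betw_def inj_on_def arc_to_ends_def by auto
  then have "digraph_isomorphism h"
    using bij unfolding digraph_isomorphism_def h_def bij_betw_def by (simp add: wf_digraph)
  moreover have "cycle_graph n = app_iso h G"
  proof -
    have "(\<lambda>a. (g (tail G a), g (head G a))) ` arcs G = (\<lambda>(u, v). (g u, g v)) ` arcs_ends G"
      unfolding arcs_ends_conv by (auto simp: image_image)
    also have "\<dots> = {(i, j). i < n \<and> j < n \<and> cyc_adj n i j}"
    proof safe
      fix u v assume uv: "u \<rightarrow> v"
      show "g u < n" "g v < n" "cyc_adj n (g u) (g v)"
        using adj[of "g u" "g v"] uv adj_in_verts[OF uv] fg g by auto
    next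
      fix i j assume "i < n" "j < n" "cyc_adj n i j"
      then show "(i, j) \<in> (\<lambda>(u, v). (g u, g v)) ` arcs_ends G"
        using adj gf by (intro image_eqI[of _ _ "(f i, f j)"]) auto
    qed
    finally show ?thesis
      using bij by (intro pre_digraph.equality)
        (auto simp: cycle_graph_def with_proj_def h_def bij_betw_def cyc_adj_def)
  qed
  ultimately show "odd_cycle G"
    unfolding odd_cycle_def digraph_iso_def using m by blast
qed

section \<open>The characterization of 3-critical graphs\<close>

lemma lower_game_vertex_critical_3_iff_odd_cycle:
  "lower_game_vertex_critical 3 G \<longleftrightarrow> odd_cycle G"
proof -
  have symR: "sym (arcs_ends G)"
    using sym_arcs unfolding symmetric_def .
  show ?thesis
  proof
    assume "lower_game_vertex_critical 3 G"
    then have nc: "\<not> two_colorable (arcs_ends G)"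
      and del: "\<And>x. x \<in> verts G \<Longrightarrow> two_colorable (arcs_ends (del_vert x))"
      unfolding lower_game_vertex_critical_3_iff by auto
    have "irrefl (arcs_ends G)"
      using adj_not_same unfolding irrefl_def by blast
    from shortest_odd_closed_walk[OF symR this nc] obtain n f
      where n: "odd n" "n \<ge> 3" and inj: "inj_on f {..<n}"
        and adj: "\<And>i j. i < n \<Longrightarrow> j < n \<Longrightarrow> f i \<rightarrow> f j \<longleftrightarrow> cyc_adj n i j"
      by blast
    have "f i \<in> verts G" if "i < n" for i
    proof -
      have "Suc i mod n < n"
        using that by simp
      then have "f i \<rightarrow> f (Suc i mod n)"
        using adj[OF that] by (simp add: cyc_adj_def)
      then show ?thesis
        by (rule adj_in_verts)
    qed
    \<comment> \<open>If the cycle missed \<open>x\<close>, it would survive in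
      \<open>del_vert x\<close>, which is two-colorable.\<close>
    moreover have "x \<in> f ` {..<n}" if "x \<in> verts G" for x
    proof (rule ccontr)
      assume "x \<notin> f ` {..<n}"
      then have "\<not> two_colorable (arcs_ends (del_vert x))"
        using adj n(1) by (intro cyc_adj_not_two_colorable[of n f]) (auto simp: arcs_ends_del_vert)
      with del[OF that] show False
        by contradiction
    qed
    ultimately have "bij_betw f {..<n} (verts G)"
      using inj by (intro bij_betw_imageI) auto
    then show "odd_cycle G"
      unfolding odd_cycle_iff using n adj by blast
  next
    assume "odd_cycle G"
    then obtain n f where n: "odd n" "n \<ge> 3" and f: "bij_betw f {..<n} (verts G)"
      and adj: "\<And>i j. i < n \<Longrightarrow> j < n \<Longrightarrow> f i \<rightarrow> f j \<longleftrightarrow> cyc_adj n i j"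
      unfolding odd_cycle_iff by blast
    have surj: "\<exists>i<n. v = f i" if "v \<in> verts G" for v
      using f that unfolding bij_betw_def by blast
    have "card (neighbours G v) < 3" if v: "v \<in> verts G" for v
    proof -
      obtain i where i: "i < n" "v = f i"
        using surj[OF v] by blast
      \<comment> \<open>The predecessor of \<open>i\<close> is written with
        \<open>i + (n - 1)\<close>, since truncated subtraction would fail at
        \<open>i = 0\<close>.\<close>
      have "neighbours G v \<subseteq> {f (Suc i mod n), f ((i + (n - 1)) mod n)}"
      proof
        fix u assume u: "u \<in> neighbours G v"
        then obtain j where j: "j < n" "u = f j"
          using surj unfolding neighbours_def by auto
        have "cyc_adj n i j"
          using u adj i j unfolding neighbours_def by auto
        moreover have "j = (i + (n - 1)) mod n" if "i = Suc j mod n"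
          using that j(1) by (cases "Suc j = n") auto
        ultimately show "u \<in> {f (Suc i mod n), f ((i + (n - 1)) mod n)}"
          using j(2) unfolding cyc_adj_def by (metis insertCI)
      qed
      then have "card (neighbours G v) \<le> card {f (Suc i mod n), f ((i + (n - 1)) mod n)}"
        by (intro card_mono) auto
      also have "\<dots> < 3"
        by (simp add: card_insert_if)
      finally show ?thesis .
    qed
    then have "\<exists>s. Ann_winning_strategy G 3 s"
      by (rule Ann_wins_if_degree_less)
    moreover have "\<not> two_colorable (arcs_ends G)"
      using n(1) adj by (intro cyc_adj_not_two_colorable[of n f]) auto
    moreover have "two_colorable (arcs_ends (del_vert x))" if "x \<in> verts G" for x
    proof -
      \<comment> \<open>Positions on the cycle; deleting \<open>x\<close> cuts it at the index
        \<open>g x\<close>.\<close>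
      define g where "g = the_inv_into {..<n} f"
      have g: "g v < n \<and> f (g v) = v" if "v \<in> verts G" for v
        using f that surj[OF that] unfolding g_def bij_betw_def
        by (auto simp: the_inv_into_f_f)
      show ?thesis
      proof (rule cyc_adj_delete_two_colorable[of n "g x" _ g])
        fix u v assume uv: "u \<rightarrow>\<^bsub>del_vert x\<^esub> v"
        then have "u \<rightarrow> v" "u \<noteq> x" "v \<noteq> x"
          by (auto simp: arcs_ends_del_vert)
        moreover from this have "u \<in> verts G" "v \<in> verts G"
          using adj_in_verts by blast+
        ultimately show "g u < n \<and> g v < n \<and> g u \<noteq> g x \<and> g v \<noteq> g x \<and> cyc_adj n (g u) (g v)"
          using g adj[of "g u" "g v"] \<open>x \<in> verts G\<close> by metis
      qed (use n g that in auto)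
    qed
    ultimately show "lower_game_vertex_critical 3 G"
      unfolding lower_game_vertex_critical_3_iff by blast
  qed
qed

end

theorem theorem13:
  fixes G :: "('a, 'b) pre_digraph"
  assumes "graph G"
  shows "lower_game_vertex_critical 3 G \<longleftrightarrow> odd_cycle G"
  using assms by (rule graph.lower_game_vertex_critical_3_iff_odd_cycle)

end
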